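(* Let $f:\mathbb{R}^n\times\mathbb{R}^m\to\mathbb{R}$, $\phi:\mathbb{R}^n\to\mathbb{R}^p$, $\varphi:\mathbb{R}^n\times\mathbb{R}^m\to\mathbb{R}^q$ be smooth (continuously differentiable), let $C\subseteq\mathbb{R}^p$, $D\subseteq\mathbb{R}^q$ be closed and convex, $X=\{x\mid\phi(x)\in C\}$, $Y(x)=\{y\mid\varphi(x,y)\in D\}$, and let $(\bar x,\bar y)$ be a calm local minimax point of $\min_{x\in X}\max_{y\in Y(x)}f(x,y)$. Suppose that MSCQ holds for the system $\phi(x)\in C$ at $\bar x$ and for the system $\varphi(\bar x,y)\in D$ at $\bar y$, respectively, and that $Y$ satisfies the Robinson stability property at $(\bar x,\bar y)$. Suppose that the regularity condition $$0=\nabla_y\varphi(\bar x,\bar y)^T\beta,\ \ \beta\in N_D(\varphi(\bar x,\bar y))\cap\{\nabla\varphi(\bar x,\bar y)(u,h)\}^\perp\ \Longrightarrow\ \beta=0$$ holds for any $u\in T_X(\bar x)$ and $h\in\mathbb{L}(\bar x,\bar y;u)$. Then there exist $\alpha\in N_C(\phi(\bar x))$ and $\beta\in N_D(\varphi(\bar x,\bar y))$ such that $$\nabla_{(x,y)}L(\bar x,\bar y,\alpha,\beta)=0.$$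
   Context: Standing assumptions: $X$ is nonempty; for each $x\in X$, $Y(x)$ is nonempty and the solution set of $\max_{y'\in Y(x)}f(x,y')$ is nonempty. $\mathbb{B}_r(z)$ is the closed Euclidean ball. Calm local minimax point: $(\bar x,\bar y)\in X\times Y(\bar x)$ such that there exist $\delta_0>0$ and $\tau:\mathbb{R}_+\to\mathbb{R}_+$ with $\tau(\delta)\to0$ as $\delta\downarrow0$, $\tau(\delta)\le\kappa\delta$ for some $\kappa>0$, and for any $\delta\in(0,\delta_0]$, $x\in X\cap\mathbb{B}_\delta(\bar x)$, $y\in Y(\bar x)\cap\mathbb{B}_\delta(\bar y)$: $f(\bar x,y)\le f(\bar x,\bar y)\le\max_{y'\in Y(x)\cap\mathbb{B}_{\tau(\delta)}(\bar y)}f(x,y')$. (Standing assumption: for the $\tau$ considered, $Y(x)\cap\mathbb{B}_{\tau(\delta)}(\bar y)\neq\emptyset$ for all small $\delta>0$ and $x\in X\cap\mathbb{B}_\delta(\bar x)$.) MSCQ for a system $g(z)\in\Sigma$ at $\bar z$ with $g(\bar z)\in\Sigma$: there are a neighborhood $U$ of $\bar z$ and $\rho>0$ with $\operatorname{dist}(z,\{z'\mid g(z')\in\Sigma\})\le\rho\operatorname{dist}(g(z),\Sigma)$ for all $z\in U$. Robinson stability of $Y$ at $(\bar x,\bar y)\in\operatorname{gph}Y$: there are $\kappa\ge0$ and neighborhoods $U$ of $\bar x$, $V$ of $\bar y$ with $\operatorname{dist}(y,Y(x))\le\kappa\operatorname{dist}(\varphi(x,y),D)$ for all $(x,y)\in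 U\times V$. $T_S(\bar z)=\{w\mid\exists t_k\downarrow0,w_k\to w,\bar z+t_kw_k\in S\}$ is the tangent cone; $N_C,N_D$ are the normal cones of convex analysis; $\{a\}^\perp$ is the orthogonal complement. $\nabla\varphi(\bar x,\bar y)(u,h)=\nabla_x\varphi(\bar x,\bar y)u+\nabla_y\varphi(\bar x,\bar y)h$. $\mathbb{L}(\bar x,\bar y;u)=\{h'\in\mathbb{R}^m\mid\nabla\varphi(\bar x,\bar y)(u,h')\in T_D(\varphi(\bar x,\bar y))\}$. $L(x,y,\alpha,\beta)=f(x,y)+\phi(x)^T\alpha-\varphi(x,y)^T\beta$. *)

theory Defs
  imports "HOL-Analysis.Analysis"
begin

definition continuously_differentiable ::
    "('a::real_normed_vector \<Rightarrow> 'b::real_normed_vector) \<Rightarrow> bool" where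
  "continuously_differentiable g \<longleftrightarrow>
     (\<exists>g' :: 'a \<Rightarrow> 'a \<Rightarrow>\<^sub>L 'b.
        (\<forall>z. (g has_derivative blinfun_apply (g' z)) (at z)) \<and> continuous_on UNIV g')"

definition tangent_cone :: "'a::real_normed_vector set \<Rightarrow> 'a \<Rightarrow> 'a set" where
  "tangent_cone S z =
     {w. \<exists>(t :: nat \<Rightarrow> real) (v :: nat \<Rightarrow> 'a).
           (\<forall>k. t k > 0) \<and> t \<longlonglongrightarrow> 0 \<and> v \<longlonglongrightarrow> w \<and> (\<forall>k. z + t k *\<^sub>R v k \<in> S)}"

(* Normal cone of convex analysis; empty at points outside S. *)
definition normal_cone :: "'a::real_inner set \<Rightarrow> 'a \<Rightarrow> 'a set" where
  "normal_cone S z = {v. z \<in> S \<and> (\<forall>z'\<in>S. v \<bullet> (z' - z) \<le> 0)}"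

(* Metric subregularity constraint qualification for the system g(z) \<in> S at z0.  Both
   sets measured by infdist are nonempty here, because g z0 \<in> S. *)
definition mscq ::
    "('a::metric_space \<Rightarrow> 'b::metric_space) \<Rightarrow> 'b set \<Rightarrow> 'a \<Rightarrow> bool" where
  "mscq g S z0 \<longleftrightarrow> g z0 \<in> S \<and>
     (\<exists>U \<rho>. open U \<and> z0 \<in> U \<and> \<rho> > 0 \<and>
        (\<forall>z\<in>U. infdist z {z'. g z' \<in> S} \<le> \<rho> * infdist (g z) S))"

(* Robinson stability of Y(x) = {y. \<psi> (x, y) \<in> D} at (x0, y0).  Since infdist y {} = 0,
   whereas the distance to the empty set is +\<infinity> by convention, Y(x) \<noteq> {} has to be
   required explicitly. *)
definition robinson_stable ::
    "('a::metric_space \<times> 'b::metric_space \<Rightarrow> 'c::metric_space) \<Rightarrow> 'c set \<Rightarrow> 'a \<Rightarrow> 'b \<Rightarrow> bool" where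
  "robinson_stable \<psi> D x0 y0 \<longleftrightarrow> \<psi> (x0, y0) \<in> D \<and>
     (\<exists>\<kappa> U V. \<kappa> \<ge> 0 \<and> open U \<and> x0 \<in> U \<and> open V \<and> y0 \<in> V \<and>
        (\<forall>x\<in>U. \<forall>y\<in>V. {y'. \<psi> (x, y') \<in> D} \<noteq> {} \<and>
           infdist y {y'. \<psi> (x, y') \<in> D} \<le> \<kappa> * infdist (\<psi> (x, y)) D))"

(* Calm local minimax point (x0, y0) of min over x \<in> X, max over y \<in> Y(x), of f.  The inequality
   f(x0, y0) \<le> max f(x, y') over Y(x) \<inter> cball y0 (\<tau> \<delta>) is expressed through a maximiser y',
   which includes the requirement that this intersection is nonempty. *)
definition calm_local_minimax ::
    "('a::metric_space \<times> 'b::metric_space \<Rightarrow> real) \<Rightarrow> 'a set \<Rightarrow> ('a \<Rightarrow> 'b set) \<Rightarrow> 'a \<Rightarrow> 'b \<Rightarrow> bool" where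
  "calm_local_minimax f X Y x0 y0 \<longleftrightarrow> x0 \<in> X \<and> y0 \<in> Y x0 \<and>
     (\<exists>\<delta>0 (\<tau> :: real \<Rightarrow> real) \<kappa>. \<delta>0 > 0 \<and> \<kappa> > 0 \<and>
        (\<forall>\<delta>\<ge>0. 0 \<le> \<tau> \<delta> \<and> \<tau> \<delta> \<le> \<kappa> * \<delta>) \<and> (\<tau> \<longlongrightarrow> 0) (at_right 0) \<and>
        (\<forall>\<delta>. 0 < \<delta> \<and> \<delta> \<le> \<delta>0 \<longrightarrow>
           (\<forall>x \<in> X \<inter> cball x0 \<delta>. \<forall>y \<in> Y x0 \<inter> cball y0 \<delta>.
              f (x0, y) \<le> f (x0, y0) \<and>
              (\<exists>y'. is_arg_max (\<lambda>y'. f (x, y')) (\<lambda>y'. y' \<in> Y x \<inter> cball y0 (\<tau> \<delta>)) y' \<and>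
                    f (x0, y0) \<le> f (x, y')))))"

definition jac_x :: "((real^'n) \<times> (real^'m) \<Rightarrow> real^'q) \<Rightarrow> real^'n \<Rightarrow> real^'m \<Rightarrow> real^'n^'q" where
  "jac_x \<psi> x y = jacobian (\<lambda>x'. \<psi> (x', y)) (at x)"

definition jac_y :: "((real^'n) \<times> (real^'m) \<Rightarrow> real^'q) \<Rightarrow> real^'n \<Rightarrow> real^'m \<Rightarrow> real^'m^'q" where
  "jac_y \<psi> x y = jacobian (\<lambda>y'. \<psi> (x, y')) (at y)"

definition grad_dir ::
    "((real^'n) \<times> (real^'m) \<Rightarrow> real^'q) \<Rightarrow> real^'n \<Rightarrow> real^'m \<Rightarrow> real^'n \<Rightarrow> real^'m \<Rightarrow> real^'q" where
  "grad_dir \<psi> x y u h = jac_x \<psi> x y *v u + jac_y \<psi> x y *v h"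

definition lin_cone ::
    "((real^'n) \<times> (real^'m) \<Rightarrow> real^'q) \<Rightarrow> (real^'q) set \<Rightarrow> real^'n \<Rightarrow> real^'m \<Rightarrow> real^'n \<Rightarrow> (real^'m) set" where
  "lin_cone \<psi> D x y u = {h'. grad_dir \<psi> x y u h' \<in> tangent_cone D (\<psi> (x, y))}"

definition lagrangian ::
    "((real^'n) \<times> (real^'m) \<Rightarrow> real) \<Rightarrow> (real^'n \<Rightarrow> real^'p) \<Rightarrow> ((real^'n) \<times> (real^'m) \<Rightarrow> real^'q)
      \<Rightarrow> real^'n \<Rightarrow> real^'m \<Rightarrow> real^'p \<Rightarrow> real^'q \<Rightarrow> real" where
  "lagrangian f \<phi> \<psi> x y \<alpha> \<beta> = f (x, y) + \<phi> x \<bullet> \<alpha> - \<psi> (x, y) \<bullet> \<beta>"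

end

theory Submission
  imports Defs
begin

text \<open>
  Write \<open>z0 = (x0, y0)\<close>.  Both multipliers come from one tool, \<open>mscq_multiplier\<close>: under
  MSCQ for \<open>g z \<in> S\<close>, a linear functional that is nonpositive on the tangent cone of the solution
  set is \<open>w \<mapsto> \<mu> \<bullet> G w\<close> with \<open>\<mu>\<close> normal to \<open>S\<close> and \<open>G\<close> the derivative of \<open>g\<close>.

  Since \<open>y0\<close> is a local maximiser of \<open>f (x0, \<cdot>)\<close> over \<open>Y x0\<close>, this tool yields \<open>\<beta>\<close> such that
  \<open>L = f - \<beta> \<bullet> \<psi>\<close> has vanishing \<open>y\<close>-derivative at \<open>z0\<close>.

  The minimisation in \<open>x\<close> is handled by weak duality: this very \<open>\<beta>\<close> also serves the outer problem.
  Take \<open>u\<close> tangent to \<open>X\<close> at \<open>x0\<close>.  Calmness provides, for \<open>x \<in> X\<close> near \<open>x0\<close>, a response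
  \<open>y \<in> Y x\<close> with \<open>f z0 \<le> f (x, y)\<close> whose distance to \<open>y0\<close> is at most a constant times that from
  \<open>x\<close> to \<open>x0\<close>.  Hence \<open>u\<close> extends to a tangent direction \<open>(u, h)\<close> of the set of all such pairs
  (\<open>tangent_cone_lift\<close>).  On that set \<open>L z0 \<le> L\<close>, because \<open>\<beta>\<close> is normal to \<open>D\<close> and \<open>\<psi>\<close> takes values
  in \<open>D\<close> there.  Thus the derivative of \<open>L\<close> along \<open>(u, h)\<close> is nonnegative
  (\<open>derivative_nonpos_on_tangent_cone\<close>), and it does not depend on \<open>h\<close>.  So the negative of the
  \<open>x\<close>-derivative of \<open>L\<close> is nonpositive on the tangent cone of \<open>X\<close>, and the tool, now applied to
  \<open>\<phi> x \<in> C\<close>, produces \<open>\<alpha>\<close>.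
\<close>

section \<open>Difference quotients along tangent sequences\<close>

lemma difference_quotient_tendsto:
  fixes g :: "'a::real_normed_vector \<Rightarrow> 'b::real_normed_vector"
  assumes g: "(g has_derivative G) (at z)"
    and t: "\<And>k::nat. t k > 0" "t \<longlonglongrightarrow> 0" and v: "v \<longlonglongrightarrow> w"
  shows "(\<lambda>k. (g (z + t k *\<^sub>R v k) - g z) /\<^sub>R t k) \<longlonglongrightarrow> G w"
proof -
  interpret G: bounded_linear G
    using g by (rule has_derivative_bounded_linear)
  \<comment> \<open>The normalised remainder takes the value 0 at \<open>z\<close>, as \<open>1 / 0 = 0\<close>; so it is continuous there,
    and indices \<open>k\<close> with \<open>v k = 0\<close> need no separate treatment in the limit.\<close>
  define r where "r y = (1 / norm (y - z)) *\<^sub>R (g y - (g z + G (y - z)))" for y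
  have "(r \<longlongrightarrow> r z) (at z)"
    using g by (simp add: has_derivative_at_within r_def[abs_def] diff_diff_eq divide_inverse_commute G.zero)
  then have r_cont: "isCont r z"
    by (simp add: isCont_def)
  have z_lim: "(\<lambda>k. z + t k *\<^sub>R v k) \<longlonglongrightarrow> z"
    using tendsto_add[OF tendsto_const[of z] tendsto_scaleR[OF t(2) v]] by simp
  have "(\<lambda>k. r (z + t k *\<^sub>R v k)) \<longlonglongrightarrow> r z"
    by (rule isCont_tendsto_compose[OF r_cont z_lim])
  then have "(\<lambda>k. norm (v k) *\<^sub>R r (z + t k *\<^sub>R v k) + G (v k)) \<longlonglongrightarrow> norm w *\<^sub>R r z + G w"
    by (intro tendsto_intros v G.tendsto)
  moreover have "norm (v k) *\<^sub>R r (z + t k *\<^sub>R v k) + G (v k) = (g (z + t k *\<^sub>R v k) - g z) /\<^sub>R t k" for k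
  proof -
    have "t k > 0" by (rule t)
    then show ?thesis
      by (cases "v k = 0") (auto simp: r_def G.scaleR algebra_simps G.zero divide_inverse)
  qed
  ultimately show ?thesis
    by (simp add: r_def)
qed

lemma derivative_nonpos_on_tangent_cone:
  fixes h :: "'a::real_normed_vector \<Rightarrow> real"
  assumes h: "(h has_derivative h') (at z)"
    and loc: "\<delta> > 0" "\<And>y. y \<in> S \<Longrightarrow> dist y z \<le> \<delta> \<Longrightarrow> h y \<le> h z"
    and w: "w \<in> tangent_cone S z"
  shows "h' w \<le> 0"
proof -
  obtain t v where t: "\<And>k::nat. t k > 0" "t \<longlonglongrightarrow> 0" and v: "v \<longlonglongrightarrow> w"
    and S: "\<And>k. z + t k *\<^sub>R v k \<in> S"
    using w by (auto simp: tangent_cone_def)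
  have z_lim: "(\<lambda>k. z + t k *\<^sub>R v k) \<longlonglongrightarrow> z"
    using tendsto_add[OF tendsto_const[of z] tendsto_scaleR[OF t(2) v]] by simp
  have "\<forall>\<^sub>F k in sequentially. dist (z + t k *\<^sub>R v k) z < \<delta>"
    using z_lim loc(1) by (rule tendstoD)
  then have "\<forall>\<^sub>F k in sequentially. (h (z + t k *\<^sub>R v k) - h z) /\<^sub>R t k \<le> 0"
  proof eventually_elim
    case (elim k)
    then have "h (z + t k *\<^sub>R v k) \<le> h z"
      using loc(2)[OF S] by auto
    then show ?case
      using t(1)[of k] by (simp add: mult_nonneg_nonpos)
  qed
  with difference_quotient_tendsto[OF h t v] show ?thesis
    by (rule tendsto_upperbound) simp
qed

text \<open>If every point of \<open>S\<close> near \<open>x0\<close> has a partner in \<open>E\<close> whose distance to \<open>y0\<close> is at most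
  proportional to the displacement of \<open>x\<close>, then the difference quotients of the partners are bounded,
  and any of their cluster points completes \<open>u\<close> to a tangent direction of \<open>E\<close>.\<close>
lemma tangent_cone_lift:
  fixes S :: "'a::real_normed_vector set" and E :: "('a \<times> 'b::euclidean_space) set"
  assumes sel: "\<delta> > 0" "\<kappa> \<ge> 0"
      "\<And>x. x \<in> S \<Longrightarrow> dist x x0 \<le> \<delta> \<Longrightarrow> \<exists>y. (x, y) \<in> E \<and> dist y y0 \<le> \<kappa> * dist x x0"
    and u: "u \<in> tangent_cone S x0"
  obtains h where "(u, h) \<in> tangent_cone E (x0, y0)"
proof -
  obtain t v where t: "\<And>k::nat. t k > 0" "t \<longlonglongrightarrow> 0" and v: "v \<longlonglongrightarrow> u"
    and S: "\<And>k. x0 + t k *\<^sub>R v k \<in> S"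
    using u by (auto simp: tangent_cone_def)
  have x_lim: "(\<lambda>k. x0 + t k *\<^sub>R v k) \<longlonglongrightarrow> x0"
    using tendsto_add[OF tendsto_const[of x0] tendsto_scaleR[OF t(2) v]] by simp
  have "\<forall>\<^sub>F k in sequentially. dist (x0 + t k *\<^sub>R v k) x0 < \<delta>"
    using x_lim sel(1) by (rule tendstoD)
  then obtain K where K: "\<And>k. k \<ge> K \<Longrightarrow> dist (x0 + t k *\<^sub>R v k) x0 < \<delta>"
    by (auto simp: eventually_sequentially)
  define s where "s k = t (k + K)" for k
  define a where "a k = v (k + K)" for k
  have s: "s k > 0" "s \<longlonglongrightarrow> 0" and a: "a \<longlonglongrightarrow> u" for k
    unfolding s_def a_def using t v by (auto intro: LIMSEQ_ignore_initial_segment)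
  have "\<exists>y. (x0 + s k *\<^sub>R a k, y) \<in> E \<and> dist y y0 \<le> \<kappa> * dist (x0 + s k *\<^sub>R a k) x0" for k
    unfolding s_def a_def using K[of "k + K"] by (intro sel(3) S) simp
  then obtain y where y: "\<And>k. (x0 + s k *\<^sub>R a k, y k) \<in> E"
      "\<And>k. dist (y k) y0 \<le> \<kappa> * dist (x0 + s k *\<^sub>R a k) x0"
    by metis
  define b where "b k = (y k - y0) /\<^sub>R s k" for k
  have b_le: "norm (b k) \<le> \<kappa> * norm (a k)" for k
  proof -
    have "norm (y k - y0) \<le> s k * (\<kappa> * norm (a k))"
      using y(2)[of k] s(1)[of k] by (simp add: dist_norm mult_ac)
    then show ?thesis
      using s(1)[of k] by (simp add: b_def divide_simps mult.commute)
  qed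
  obtain B where B: "\<And>k. norm (a k) \<le> B"
    using convergent_imp_Bseq[OF convergentI[OF a]] by (auto simp: Bseq_def)
  have "norm (b k) \<le> \<kappa> * B" for k
    using b_le[of k] mult_left_mono[OF B[of k] sel(2)] by linarith
  then have "bounded (range b)"
    by (auto simp: bounded_iff)
  then obtain h r where r: "strict_mono r" and h: "(b \<circ> r) \<longlonglongrightarrow> h"
    using bounded_imp_convergent_subsequence by blast
  have "(s \<circ> r) \<longlonglongrightarrow> 0" "(\<lambda>k. ((a \<circ> r) k, (b \<circ> r) k)) \<longlonglongrightarrow> (u, h)"
    using LIMSEQ_subseq_LIMSEQ[OF s(2) r] LIMSEQ_subseq_LIMSEQ[OF a r] h
    by (auto intro: tendsto_Pair simp: o_def)
  moreover have "(x0, y0) + (s \<circ> r) k *\<^sub>R ((a \<circ> r) k, (b \<circ> r) k) \<in> E" for k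
    using y(1)[of "r k"] s(1)[of "r k"] by (simp add: b_def)
  moreover have "(s \<circ> r) k > 0" for k
    using s(1) by simp
  ultimately have "(u, h) \<in> tangent_cone E (x0, y0)"
    unfolding tangent_cone_def
    by (intro CollectI exI[of _ "s \<circ> r"] exI[of _ "\<lambda>k. ((a \<circ> r) k, (b \<circ> r) k)"]) simp
  then show thesis ..
qed

section \<open>Multipliers under metric subregularity\<close>

lemma closed_normal_cone: "closed (normal_cone S z)"
proof -
  have "normal_cone S z = (if z \<in> S then (\<Inter>z'\<in>S. {v. (z' - z) \<bullet> v \<le> 0}) else {})"
    by (auto simp: normal_cone_def inner_commute)
  then show ?thesis
    by (auto intro!: closed_INT closed_halfspace_le)
qed

lemma convex_normal_cone: "convex (normal_cone S z)"
proof -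
  have "normal_cone S z = (if z \<in> S then (\<Inter>z'\<in>S. {v. (z' - z) \<bullet> v \<le> 0}) else {})"
    by (auto simp: normal_cone_def inner_commute)
  then show ?thesis
    by (auto intro!: convex_INT convex_halfspace_le)
qed

lemma normal_cone_scaleR: "v \<in> normal_cone S z \<Longrightarrow> c \<ge> 0 \<Longrightarrow> c *\<^sub>R v \<in> normal_cone S z"
  by (auto simp: normal_cone_def mult_nonneg_nonpos)

text \<open>Move from \<open>z0\<close> a step \<open>t\<close> in direction \<open>w\<close> and project twice: the moved point onto the
  solution set, and its image under \<open>g\<close> onto \<open>S\<close>.  After division by \<open>t\<close>, the first projection
  yields, along a subsequence, a tangent direction \<open>w'\<close>, and the residual of the second a normal vector \<open>\<mu>\<close>.
  MSCQ compares the two residuals, so \<open>norm \<mu>\<close> controls how far \<open>w\<close> is from being tangent.  The last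
  estimate says that \<open>\<mu>\<close> detects the violation of the constraint along \<open>w\<close>.\<close>
lemma mscq_directional_multiplier:
  fixes g :: "'a::euclidean_space \<Rightarrow> 'b::euclidean_space"
  assumes g: "(g has_derivative G) (at z0)" and cont: "continuous_on UNIV g"
    and S: "closed S" "convex S" and z0: "g z0 \<in> S"
    and \<rho>: "\<rho> > 0"
    and U: "open U" "z0 \<in> U" "\<And>z. z \<in> U \<Longrightarrow> infdist z {z'. g z' \<in> S} \<le> \<rho> * infdist (g z) S"
  obtains \<mu> w' where "\<mu> \<in> normal_cone S (g z0)" "w' \<in> tangent_cone {z. g z \<in> S} z0"
    "norm (w - w') \<le> \<rho> * norm \<mu>" "(norm \<mu>)\<^sup>2 \<le> \<mu> \<bullet> G w"
proof -
  define M where "M = {z. g z \<in> S}"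
  have M_closed: "closed M"
    using closed_vimage[OF S(1) cont] by (simp add: M_def vimage_def)
  have z0_M: "z0 \<in> M"
    using z0 by (simp add: M_def)
  define t where "t k = inverse (real (Suc k))" for k
  have t: "t k > 0" "t \<longlonglongrightarrow> 0" for k
    unfolding t_def by (simp, rule LIMSEQ_inverse_real_of_nat)
  define z where "z k = z0 + t k *\<^sub>R w" for k
  define m where "m k = closest_point M (z k)" for k
  define s where "s k = closest_point S (g (z k))" for k
  have m: "m k \<in> M" "dist (z k) (m k) \<le> infdist (z k) M" "dist (z k) (m k) \<le> dist (z k) z0" for k
    unfolding m_def using closest_point_in_set[OF M_closed] closest_point_le[OF M_closed z0_M]
      setdist_closest_point[OF M_closed] z0_M by (force simp: infdist_eq_setdist)+
  have s: "s k \<in> S" "\<And>q. q \<in> S \<Longrightarrow> (g (z k) - s k) \<bullet> (q - s k) \<le> 0" for k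
    unfolding s_def using closest_point_in_set[OF S(1)] closest_point_dot[OF S(2,1)] z0 by auto
  define a where "a k = (m k - z0) /\<^sub>R t k" for k
  define l where "l k = (g (z k) - s k) /\<^sub>R t k" for k
  define d where "d k = (g (z k) - g z0) /\<^sub>R t k" for k
  have m_eq: "m k = z0 + t k *\<^sub>R a k" and s_eq: "s k = g (z k) - t k *\<^sub>R l k" for k
    using t(1)[of k] by (simp_all add: a_def l_def)
  \<comment> \<open>By the obtuse angle property of projections, \<open>l k\<close> is normal to \<open>S\<close> at \<open>s k\<close>; testing this
    with the point \<open>g z0\<close> of \<open>S\<close> gives the quadratic estimate.\<close>
  have l_normal: "l k \<bullet> (q - s k) \<le> 0" if "q \<in> S" for k q
    using s(2)[OF that, of k] t(1)[of k] by (simp add: l_def divide_simps)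
  have l_d: "(norm (l k))\<^sup>2 \<le> l k \<bullet> d k" for k
  proof -
    have "d k - l k = (- 1 / t k) *\<^sub>R (g z0 - s k)"
      by (simp add: d_def l_def algebra_simps divide_inverse)
    then have "l k \<bullet> (d k - l k) = (- 1 / t k) * (l k \<bullet> (g z0 - s k))"
      by (simp only: inner_scaleR_right)
    also have "\<dots> \<ge> 0"
      using l_normal[OF z0, of k] t(1)[of k] by (simp add: divide_nonpos_pos)
    finally show ?thesis
      by (simp add: inner_diff_right power2_norm_eq_inner)
  qed
  have d_lim: "d \<longlonglongrightarrow> G w"
    unfolding d_def z_def by (rule difference_quotient_tendsto[OF g t tendsto_const])
  have z_lim: "z \<longlonglongrightarrow> z0"
    unfolding z_def using tendsto_add[OF tendsto_const[of z0] tendsto_scaleR[OF t(2) tendsto_const[of w]]]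
    by simp
  obtain B where B: "\<And>k. norm (d k) \<le> B"
    using convergent_imp_Bseq[OF convergentI[OF d_lim]] by (auto simp: Bseq_def)
  have l_le: "norm (l k) \<le> B" for k
  proof (cases "l k = 0")
    case True
    then show ?thesis using order_trans[OF norm_ge_zero B[of k]] by simp
  next
    case False
    have "norm (l k) * norm (l k) \<le> norm (l k) * norm (d k)"
      using l_d[of k] norm_cauchy_schwarz[of "l k" "d k"] by (simp add: power2_eq_square)
    then show ?thesis
      using False B[of k] by simp
  qed
  have w_a: "norm (w - a k) = dist (z k) (m k) / t k" for k
  proof -
    have "z k - m k = t k *\<^sub>R (w - a k)"
      by (simp add: m_eq z_def algebra_simps)
    then show ?thesis
      using t(1)[of k] by (simp add: dist_norm)
  qed
  have "norm (w - a k) \<le> norm w" for k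
    using m(3)[of k] t(1)[of k] by (simp add: w_a z_def dist_norm divide_simps mult.commute)
  then have "norm (a k) \<le> 2 * norm w" for k
    using norm_triangle_sub[of "a k" w] by (smt (verit) norm_minus_commute)
  with l_le have "norm (a k, l k) \<le> 2 * norm w + B" for k
    using norm_Pair_le[of "a k" "l k"] by (smt (verit))
  then have "bounded (range (\<lambda>k. (a k, l k)))"
    by (auto simp: bounded_iff)
  then obtain p r where r: "strict_mono r" and p: "((\<lambda>k. (a k, l k)) \<circ> r) \<longlonglongrightarrow> p"
    using bounded_imp_convergent_subsequence by blast
  obtain w' \<mu> where p_eq: "p = (w', \<mu>)"
    by (cases p)
  have a_lim: "(\<lambda>k. a (r k)) \<longlonglongrightarrow> w'" and l_lim: "(\<lambda>k. l (r k)) \<longlonglongrightarrow> \<mu>"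
    using tendsto_fst[OF p] tendsto_snd[OF p] by (simp_all add: p_eq o_def)
  have t_lim: "(\<lambda>k. t (r k)) \<longlonglongrightarrow> 0" and z_lim': "(\<lambda>k. z (r k)) \<longlonglongrightarrow> z0"
    and d_lim': "(\<lambda>k. d (r k)) \<longlonglongrightarrow> G w"
    using LIMSEQ_subseq_LIMSEQ[OF t(2) r] LIMSEQ_subseq_LIMSEQ[OF z_lim r]
      LIMSEQ_subseq_LIMSEQ[OF d_lim r] by (simp_all add: o_def)
  have "isCont g z0"
    using cont by (simp add: continuous_on_eq_continuous_at)
  then have "(\<lambda>k. g (z (r k)) - t (r k) *\<^sub>R l (r k)) \<longlonglongrightarrow> g z0 - 0 *\<^sub>R \<mu>"
    by (intro tendsto_intros isCont_tendsto_compose[of z0 g] z_lim' t_lim l_lim)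
  then have s_lim: "(\<lambda>k. s (r k)) \<longlonglongrightarrow> g z0"
    by (simp add: s_eq)
  have "\<mu> \<bullet> (q - g z0) \<le> 0" if "q \<in> S" for q
  proof (rule tendsto_upperbound)
    show "(\<lambda>k. l (r k) \<bullet> (q - s (r k))) \<longlonglongrightarrow> \<mu> \<bullet> (q - g z0)"
      by (intro tendsto_intros l_lim s_lim)
  qed (simp_all add: l_normal that)
  then have \<mu>: "\<mu> \<in> normal_cone S (g z0)"
    using z0 by (simp add: normal_cone_def)
  have "z0 + t (r k) *\<^sub>R a (r k) \<in> M" for k
    using m(1)[of "r k"] by (simp add: m_eq)
  then have w': "w' \<in> tangent_cone {z. g z \<in> S} z0"
    unfolding tangent_cone_def M_def[symmetric] using t(1) t_lim a_lim
    by (intro CollectI exI[of _ "\<lambda>k. t (r k)"] exI[of _ "\<lambda>k. a (r k)"]) simp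
  have "\<forall>\<^sub>F k in sequentially. z (r k) \<in> U"
    using topological_tendstoD[OF z_lim' U(1,2)] .
  then have "\<forall>\<^sub>F k in sequentially. norm (w - a (r k)) \<le> \<rho> * norm (l (r k))"
  proof eventually_elim
    case (elim k)
    let ?k = "r k"
    have "dist (z ?k) (m ?k) \<le> \<rho> * infdist (g (z ?k)) S"
      using m(2)[of ?k] U(3)[OF elim] by (simp add: M_def)
    also have "\<dots> \<le> \<rho> * dist (g (z ?k)) (s ?k)"
      using \<rho> infdist_le[OF s(1)] by (intro mult_left_mono) auto
    also have "dist (g (z ?k)) (s ?k) = t ?k * norm (l ?k)"
      using t(1)[of ?k] by (simp add: s_eq dist_norm)
    finally show ?case
      using t(1)[of ?k] by (simp add: w_a divide_simps mult_ac)
  qed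
  then have w_w': "norm (w - w') \<le> \<rho> * norm \<mu>"
    by (rule tendsto_le[OF sequentially_bot, rotated 2]) (intro tendsto_intros a_lim l_lim)+
  have "(norm \<mu>)\<^sup>2 \<le> \<mu> \<bullet> G w"
    by (rule LIMSEQ_le[of "\<lambda>k. (norm (l (r k)))\<^sup>2" _ "\<lambda>k. l (r k) \<bullet> d (r k)"])
      (auto intro!: tendsto_intros l_lim d_lim' l_d)
  with \<mu> w' w_w' show thesis ..
qed

text \<open>The cone of all \<open>adjoint G \<mu>\<close> with \<open>\<mu>\<close> normal to \<open>S\<close> is not closed for general \<open>G\<close> and \<open>S\<close>,
  so the vector \<open>v\<close> representing \<open>l\<close> cannot be separated from it directly.  MSCQ bounds the multiplier a priori by
  \<open>R = \<rho> * norm v\<close>, and the image of the multipliers of norm at most \<open>R\<close> is compact and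
  convex.  A direction \<open>w\<close> separating \<open>v\<close> strictly from that image contradicts
  \<open>mscq_directional_multiplier\<close>, once the normal vector obtained there is rescaled to norm \<open>R\<close>.\<close>
lemma mscq_multiplier:
  fixes g :: "'a::euclidean_space \<Rightarrow> 'b::euclidean_space" and l :: "'a \<Rightarrow> real"
  assumes g: "(g has_derivative G) (at z0)" and cont: "continuous_on UNIV g"
    and S: "closed S" "convex S" and mscq: "mscq g S z0"
    and l: "linear l" "\<And>w. w \<in> tangent_cone {z. g z \<in> S} z0 \<Longrightarrow> l w \<le> 0"
  obtains \<mu> where "\<mu> \<in> normal_cone S (g z0)" "\<And>w. l w = \<mu> \<bullet> G w"
proof -
  obtain U \<rho> where z0: "g z0 \<in> S" and U: "open U" "z0 \<in> U" and \<rho>: "\<rho> > 0"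
    and regular: "\<And>z. z \<in> U \<Longrightarrow> infdist z {z'. g z' \<in> S} \<le> \<rho> * infdist (g z) S"
    using mscq by (auto simp: mscq_def)
  have G_lin: "linear G"
    using g by (rule has_derivative_linear)
  define v where "v = adjoint l 1"
  have v: "w \<bullet> v = l w" for w
    using adjoint_works[OF l(1), of w 1] by (simp add: v_def)
  define R where "R = \<rho> * norm v"
  have R: "R \<ge> 0"
    using \<rho> by (simp add: R_def)
  define K where "K = normal_cone S (g z0) \<inter> cball 0 R"
  define A where "A = adjoint G ` K"
  have K: "compact K" "convex K"
    unfolding K_def by (auto intro: closed_Int_compact closed_normal_cone convex_Int convex_normal_cone)
  have A_closed: "closed A"
    unfolding A_def using K(1) adjoint_linear[OF G_lin]
    by (intro compact_imp_closed compact_continuous_image linear_continuous_on)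
      (auto simp: linear_conv_bounded_linear)
  have A_convex: "convex A"
    unfolding A_def by (intro convex_linear_image adjoint_linear G_lin K)
  have "v \<in> A"
  proof (rule ccontr)
    assume "v \<notin> A"
    from separating_hyperplane_closed_point[OF A_convex A_closed this]
    obtain c b where c: "c \<bullet> v < b" "\<And>x. x \<in> A \<Longrightarrow> b < c \<bullet> x"
      by blast
    define w where "w = - c"
    have w: "\<nu> \<bullet> G w < l w" if "\<nu> \<in> K" for \<nu>
    proof -
      have "c \<bullet> v < c \<bullet> adjoint G \<nu>"
        using c(1) c(2)[of "adjoint G \<nu>"] that by (auto simp: A_def)
      then have "w \<bullet> adjoint G \<nu> < w \<bullet> v"
        by (simp add: w_def)
      then show ?thesis
        by (simp add: adjoint_works[OF G_lin] v inner_commute[of \<nu>])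
    qed
    obtain \<mu> w' where \<mu>: "\<mu> \<in> normal_cone S (g z0)" and w': "w' \<in> tangent_cone {z. g z \<in> S} z0"
      and w_w': "norm (w - w') \<le> \<rho> * norm \<mu>" and \<mu>_G: "(norm \<mu>)\<^sup>2 \<le> \<mu> \<bullet> G w"
      using mscq_directional_multiplier[OF g cont S z0 \<rho> U regular, where w = w] by blast
    have "l w = l w' + (w - w') \<bullet> v"
      by (simp add: v linear_diff[OF l(1)])
    also have "\<dots> \<le> 0 + norm (w - w') * norm v"
      by (intro add_mono l(2) w' norm_cauchy_schwarz)
    also have "\<dots> \<le> R * norm \<mu>"
      using mult_right_mono[OF w_w' norm_ge_zero[of v]] by (simp add: R_def mult_ac)
    finally have l_le: "l w \<le> R * norm \<mu>" .
    \<comment> \<open>For \<open>\<mu> = 0\<close> this is the zero vector, which also lies in \<open>K\<close>.\<close>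
    define \<nu> where "\<nu> = (R / norm \<mu>) *\<^sub>R \<mu>"
    have "\<nu> \<in> K"
      using R normal_cone_scaleR[OF \<mu>, of "R / norm \<mu>"] by (auto simp: K_def \<nu>_def)
    moreover have "R * norm \<mu> \<le> \<nu> \<bullet> G w"
    proof (cases "\<mu> = 0")
      case False
      have "R * norm \<mu> = R / norm \<mu> * (norm \<mu>)\<^sup>2"
        using False by (simp add: power2_eq_square)
      also have "\<dots> \<le> \<nu> \<bullet> G w"
        unfolding \<nu>_def inner_scaleR_left using R by (intro mult_left_mono \<mu>_G) simp
      finally show ?thesis .
    qed (simp add: \<nu>_def)
    ultimately show False
      using w l_le by force
  qed
  then obtain \<mu> where \<mu>: "\<mu> \<in> normal_cone S (g z0)" and v_eq: "v = adjoint G \<mu>"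
    by (auto simp: A_def K_def)
  have "l w = \<mu> \<bullet> G w" for w
    using v[of w] by (simp add: v_eq adjoint_works[OF G_lin] inner_commute)
  with \<mu> show thesis ..
qed

section \<open>First-order conditions at calm local minimax points\<close>

theorem theorem5p1:
  fixes f :: "(real^'n) \<times> (real^'m) \<Rightarrow> real"
    and \<phi> :: "real^'n \<Rightarrow> real^'p"
    and \<psi> :: "(real^'n) \<times> (real^'m) \<Rightarrow> real^'q"
    and C :: "(real^'p) set" and D :: "(real^'q) set"
    and X :: "(real^'n) set" and Y :: "real^'n \<Rightarrow> (real^'m) set"
    and x0 :: "real^'n" and y0 :: "real^'m"
  assumes smooth: "continuously_differentiable f" "continuously_differentiable \<phi>"
      "continuously_differentiable \<psi>"
    and C: "closed C" "convex C"
    and D: "closed D" "convex D"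
    and X_def: "X = {x. \<phi> x \<in> C}"
    and Y_def: "Y = (\<lambda>x. {y. \<psi> (x, y) \<in> D})"
    and X_nonempty: "X \<noteq> {}"
    and Y_nonempty: "\<forall>x\<in>X. Y x \<noteq> {}"
    and solvable: "\<forall>x\<in>X. {y. is_arg_max (\<lambda>y'. f (x, y')) (\<lambda>y'. y' \<in> Y x) y} \<noteq> {}"
    and calm: "calm_local_minimax f X Y x0 y0"
    and mscq_x: "mscq \<phi> C x0"
    and mscq_y: "mscq (\<lambda>y. \<psi> (x0, y)) D y0"
    and robinson: "robinson_stable \<psi> D x0 y0"
    and regularity:
      "\<forall>u \<in> tangent_cone X x0. \<forall>h \<in> lin_cone \<psi> D x0 y0 u. \<forall>\<beta>.
         0 = transpose (jac_y \<psi> x0 y0) *v \<beta> \<and>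
         \<beta> \<in> normal_cone D (\<psi> (x0, y0)) \<inter> {grad_dir \<psi> x0 y0 u h}\<^sup>\<bottom> \<longrightarrow> \<beta> = 0"
  shows "\<exists>\<alpha> \<in> normal_cone C (\<phi> x0). \<exists>\<beta> \<in> normal_cone D (\<psi> (x0, y0)).
           GDERIV (\<lambda>(x, y). lagrangian f \<phi> \<psi> x y \<alpha> \<beta>) (x0, y0) :> 0"
proof -
  obtain f' where f': "(f has_derivative f') (at (x0, y0))"
    using smooth(1) unfolding continuously_differentiable_def by blast
  obtain \<phi>' where \<phi>': "\<And>x. (\<phi> has_derivative blinfun_apply (\<phi>' x)) (at x)"
    using smooth(2) unfolding continuously_differentiable_def by blast
  obtain \<psi>' where \<psi>': "\<And>z. (\<psi> has_derivative blinfun_apply (\<psi>' z)) (at z)"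
    using smooth(3) unfolding continuously_differentiable_def by blast
  define P where "P = blinfun_apply (\<phi>' x0)"
  define Q where "Q = blinfun_apply (\<psi>' (x0, y0))"
  have P: "(\<phi> has_derivative P) (at x0)" and Q: "(\<psi> has_derivative Q) (at (x0, y0))"
    using \<phi>' \<psi>' by (auto simp: P_def Q_def)
  interpret f': bounded_linear f' using f' by (rule has_derivative_bounded_linear)
  interpret P: bounded_linear P using P by (rule has_derivative_bounded_linear)
  interpret Q: bounded_linear Q using Q by (rule has_derivative_bounded_linear)
  have \<phi>_cont: "continuous_on UNIV \<phi>" and \<psi>_cont: "continuous_on UNIV \<psi>"
    using \<phi>' \<psi>' by (meson has_derivative_continuous continuous_at_imp_continuous_on)+
  obtain \<delta>0 \<tau> \<kappa> where \<delta>0: "\<delta>0 > 0" and \<kappa>: "\<kappa> > 0"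
    and \<tau>: "\<And>\<delta>. \<delta> \<ge> 0 \<Longrightarrow> \<tau> \<delta> \<le> \<kappa> * \<delta>"
    and minimax: "\<And>\<delta> x y. 0 < \<delta> \<Longrightarrow> \<delta> \<le> \<delta>0 \<Longrightarrow> x \<in> X \<inter> cball x0 \<delta> \<Longrightarrow> y \<in> Y x0 \<inter> cball y0 \<delta> \<Longrightarrow>
        f (x0, y) \<le> f (x0, y0) \<and>
        (\<exists>y'. is_arg_max (\<lambda>y'. f (x, y')) (\<lambda>y'. y' \<in> Y x \<inter> cball y0 (\<tau> \<delta>)) y' \<and>
              f (x0, y0) \<le> f (x, y'))"
    and x0: "x0 \<in> X" and y0: "y0 \<in> Y x0"
    using calm unfolding calm_local_minimax_def by (elim conjE exE) blast
  have in_y: "((\<lambda>y. (x0, y)) has_derivative (\<lambda>h. (0, h))) (at y0)"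
    by (auto intro!: derivative_eq_intros)
  have f_y: "((\<lambda>y. f (x0, y)) has_derivative (\<lambda>h. f' (0, h))) (at y0)"
    using has_derivative_compose[OF in_y f'] .
  have \<psi>_y: "((\<lambda>y. \<psi> (x0, y)) has_derivative (\<lambda>h. Q (0, h))) (at y0)"
    using has_derivative_compose[OF in_y Q] .
  have \<psi>_y_cont: "continuous_on UNIV (\<lambda>y. \<psi> (x0, y))"
    by (rule continuous_on_compose2[OF \<psi>_cont]) (auto intro: continuous_intros)
  have inner_max: "f' (0, h) \<le> 0" if "h \<in> tangent_cone {y. \<psi> (x0, y) \<in> D} y0" for h
  proof (rule derivative_nonpos_on_tangent_cone[OF f_y \<delta>0 _ that])
    fix y assume "y \<in> {y. \<psi> (x0, y) \<in> D}" "dist y y0 \<le> \<delta>0"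
    then show "f (x0, y) \<le> f (x0, y0)"
      using minimax[of \<delta>0 x0 y] \<delta>0 x0 by (simp add: Y_def dist_commute)
  qed
  have "linear (\<lambda>h. f' (0, h))"
    using has_derivative_linear[OF f_y] .
  then obtain \<beta> where \<beta>: "\<beta> \<in> normal_cone D (\<psi> (x0, y0))" and \<beta>_y: "\<And>h. f' (0, h) = \<beta> \<bullet> Q (0, h)"
    using mscq_multiplier[OF \<psi>_y \<psi>_y_cont D mscq_y, of "\<lambda>h. f' (0, h)"] inner_max by blast
  \<comment> \<open>Calm responses of the maximising player lead to points of \<open>E\<close>, and over \<open>E\<close> the function
    \<open>f - \<beta> \<bullet> \<psi>\<close> is minimised at \<open>(x0, y0)\<close>.\<close>
  define E where "E = {(x, y). y \<in> Y x \<and> f (x0, y0) \<le> f (x, y)}"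
  have sel: "\<exists>y. (x, y) \<in> E \<and> dist y y0 \<le> \<kappa> * dist x x0" if x: "x \<in> X" "dist x x0 \<le> \<delta>0" for x
  proof (cases "x = x0")
    \<comment> \<open>The radius \<open>dist x x0\<close> used below must be positive, so here \<open>y0\<close> itself serves.\<close>
    case True
    then show ?thesis using y0 by (auto simp: E_def)
  next
    case False
    then obtain y where "y \<in> Y x" "dist y0 y \<le> \<tau> (dist x x0)" "f (x0, y0) \<le> f (x, y)"
      using minimax[of "dist x x0" x y0] x y0 by (auto simp: is_arg_max_def dist_commute)
    with \<tau>[of "dist x x0"] show ?thesis
      by (auto simp: E_def dist_commute intro!: exI[of _ y])
  qed
  have L': "((\<lambda>z. \<beta> \<bullet> \<psi> z - f z) has_derivative (\<lambda>d. \<beta> \<bullet> Q d - f' d)) (at (x0, y0))"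
    by (intro derivative_intros Q f')
  have outer_min: "\<beta> \<bullet> Q (u, 0) - f' (u, 0) \<le> 0" if u: "u \<in> tangent_cone {x. \<phi> x \<in> C} x0" for u
  proof -
    obtain h where h: "(u, h) \<in> tangent_cone E (x0, y0)"
      using tangent_cone_lift[OF \<delta>0 _ sel] u \<kappa> X_def by (metis less_imp_le)
    have "\<beta> \<bullet> Q (u, h) - f' (u, h) \<le> 0"
    proof (rule derivative_nonpos_on_tangent_cone[OF L' zero_less_one _ h])
      fix z assume "z \<in> E"
      then have "\<psi> z \<in> D" "f (x0, y0) \<le> f z"
        by (auto simp: E_def Y_def)
      moreover have "\<beta> \<bullet> (\<psi> z - \<psi> (x0, y0)) \<le> 0"
        using \<beta> \<open>\<psi> z \<in> D\<close> by (simp add: normal_cone_def)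
      ultimately show "\<beta> \<bullet> \<psi> z - f z \<le> \<beta> \<bullet> \<psi> (x0, y0) - f (x0, y0)"
        by (simp add: inner_diff_right)
    qed
    moreover have "Q (u, h) = Q (u, 0) + Q (0, h)" "f' (u, h) = f' (u, 0) + f' (0, h)"
      by (simp_all flip: Q.add f'.add)
    ultimately show ?thesis
      using \<beta>_y[of h] by (simp add: inner_add_right)
  qed
  have "linear (\<lambda>u. \<beta> \<bullet> Q (u, 0) - f' (u, 0))"
  proof -
    have "bounded_linear (\<lambda>u. \<beta> \<bullet> Q (u, 0) - f' (u, 0))"
      by (intro bounded_linear_intros Q.bounded_linear_axioms f'.bounded_linear_axioms
          bounded_linear_compose[of Q] bounded_linear_compose[of f'] bounded_linear_Pair)
    then show ?thesis by (rule bounded_linear.linear)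
  qed
  then obtain \<alpha> where \<alpha>: "\<alpha> \<in> normal_cone C (\<phi> x0)"
    and \<alpha>_x: "\<And>u. \<beta> \<bullet> Q (u, 0) - f' (u, 0) = \<alpha> \<bullet> P u"
    using mscq_multiplier[OF P \<phi>_cont C mscq_x, of "\<lambda>u. \<beta> \<bullet> Q (u, 0) - f' (u, 0)"] outer_min by blast
  have "f' (u, h) + P u \<bullet> \<alpha> - Q (u, h) \<bullet> \<beta> = 0" for u h
  proof -
    have "Q (u, h) = Q (u, 0) + Q (0, h)" "f' (u, h) = f' (u, 0) + f' (0, h)"
      by (simp_all flip: Q.add f'.add)
    then show ?thesis
      using \<alpha>_x[of u] \<beta>_y[of h] by (simp add: inner_commute[of _ \<alpha>] inner_commute[of _ \<beta>] inner_add_right)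
  qed
  then have zero: "f' d + P (fst d) \<bullet> \<alpha> - Q d \<bullet> \<beta> = 0" for d
    by (cases d) simp
  have \<phi>_fst: "((\<lambda>z. \<phi> (fst z)) has_derivative (\<lambda>d. P (fst d))) (at (x0, y0))"
    using has_derivative_compose[OF has_derivative_fst[OF has_derivative_ident], of \<phi> P "(x0, y0)"] P
    by simp
  have "((\<lambda>z. f z + \<phi> (fst z) \<bullet> \<alpha> - \<psi> z \<bullet> \<beta>) has_derivative
      (\<lambda>d. f' d + P (fst d) \<bullet> \<alpha> - Q d \<bullet> \<beta>)) (at (x0, y0))"
    by (intro derivative_intros \<phi>_fst Q f')
  then have "GDERIV (\<lambda>(x, y). lagrangian f \<phi> \<psi> x y \<alpha> \<beta>) (x0, y0) :> 0"
    by (simp add: zero gderiv_def lagrangian_def case_prod_unfold)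
  with \<alpha> \<beta> show ?thesis by blast
qed

end
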